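(* Let $S$ and $X$ be nonnegative integers. The number of unordered pairs $\{a,b\}$ of positive integers with $a+b=S$ and $a\oplus b = X$ equals $f(S,X)$, where $$f(S,X)=\begin{cases} 0 & \text{if } S-X \text{ is odd},\\ 0 & \text{if } S-X \text{ is even and for some } i \text{ the } i\text{th binary digit of } \tfrac{S-X}{2} \text{ and of } X \text{ both equal } 1,\\ 2^{g(X)-1}-1 & \text{otherwise, if } S=X,\\ 2^{g(X)-1} & \text{otherwise (} S-X \text{ even).}\end{cases}$$ (The cases are checked in the order listed.)
   Context: $\oplus$ denotes bitwise exclusive-or of nonnegative integers. For a nonnegative integer $n$, $g(n)$ denotes the number of $1$s in the binary expansion of $n$ (so $g(0)=0$, $g(1)=1$, and $g(n)=(n \bmod 2)+g(\lfloor n/2\rfloor)$). Binary digits of a negative integer are taken in two's complement.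
   Formalization: At X = 0 the exponent g(X)−1 = −1 would give 1/2 or −1/2, which is not a count (for S = 2, X = 0 the only pair is {1,1}); there the exponent is read as 0. Pairs with a = b are allowed. For X ≥ 1 the formula is unchanged. *)

theory Defs
  imports Main
begin

definition popcount :: "nat \<Rightarrow> nat" where
  "popcount n = card {i. bit n i}"

lemma popcount_0: "popcount 0 = 0"
  by (simp add: popcount_def)

lemma finite_bits_nat: "finite {i. bit (n::nat) i}"
proof (rule finite_subset)
  show "{i. bit n i} \<subseteq> {..<n}"
  proof
    fix i assume "i \<in> {i. bit n i}"
    then have "\<not> n < 2 ^ i" by (auto simp: bit_iff_odd)
    moreover have "i < 2 ^ i" by simp
    ultimately have "i < n" by linarith
    then show "i \<in> {..<n}" by simp
  qed
qed simp

lemma popcount_rec: "popcount n = n mod 2 + popcount (n div 2)"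
proof -
  have eq: "{i. bit n i} = (if odd n then {0} else {}) \<union> Suc ` {i. bit (n div 2) i}"
  proof (rule set_eqI)
    fix i
    show "i \<in> {i. bit n i} \<longleftrightarrow>
      i \<in> (if odd n then {0} else {}) \<union> Suc ` {i. bit (n div 2) i}"
      by (cases i) (auto simp: bit_0 bit_Suc)
  qed
  have "card (Suc ` {i. bit (n div 2) i}) = popcount (n div 2)"
    by (simp add: popcount_def card_image)
  then show ?thesis
    unfolding popcount_def [of n] eq
    by (auto simp: card_insert_if finite_bits_nat odd_iff_mod_2_eq_one)
qed

text \<open>
  \<open>bit\<close> on \<^typ>\<open>int\<close> is two's complement, so the second case is meaningful also for \<open>S < X\<close>.

  The exponent \<open>popcount X - 1\<close> is a subtraction on \<^typ>\<open>nat\<close>. It differs from the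
  integer difference
  only at \<open>X = 0\<close>, where \<open>2\<close> to the power \<open>-1\<close> could not be a count; there the
  exponent is read as \<open>0\<close>. The outer subtraction of \<open>1\<close> is on \<^typ>\<open>int\<close>.
\<close>

definition pair_formula :: "nat \<Rightarrow> nat \<Rightarrow> int" where
  "pair_formula S X =
    (if odd (int S - int X) then 0
     else if \<exists>i. bit ((int S - int X) div 2) i \<and> bit X i then 0
     else if S = X then 2 ^ (popcount X - 1) - 1
     else 2 ^ (popcount X - 1))"

text \<open>
  A set \<open>{a, b}\<close> of naturals represents an unordered pair with \<open>a = b\<close> allowed, as a singleton
  (this happens only for \<open>X = 0\<close>).
\<close>

definition xor_pairs :: "nat \<Rightarrow> nat \<Rightarrow> nat set set" where
  "xor_pairs S X = {{a, b} | a b. 0 < a \<and> 0 < b \<and> a + b = S \<and> xor a b = X}"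

end

theory Submission
  imports Defs
begin

text \<open>
  Separating carries from digit sums gives \<open>a + b = (a XOR b) + 2 (a AND b)\<close>. So \<open>a + b = S\<close> and
  \<open>a XOR b = X\<close> hold exactly if \<open>a XOR b = X\<close> and \<open>a AND b = D\<close> with \<open>S = X + 2 D\<close>. Such pairs
  exist only if \<open>D\<close> and \<open>X\<close> have no common bit, and then they arise by distributing the bits of
  \<open>X\<close> among \<open>a\<close> and \<open>b\<close>. Fixing one bit of \<open>X\<close> to belong to \<open>b\<close> selects one of the two orders of
  each unordered pair, leaving \<open>g(X) - 1\<close> free choices (for \<open>X = 0\<close> the only pair is \<open>{D, D}\<close>).
  A zero entry occurs only in \<open>{0, X}\<close>, when \<open>D = 0\<close>.

  The formula also vanishes for \<open>S < X\<close>: if \<open>(S - X) / 2\<close> and \<open>X\<close> have no common bit, then their OR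
  equals their sum \<open>(S + X) / 2 \<ge> 0\<close>, and an OR is nonnegative only if both operands are.
\<close>

lemma and_eq_0_iff_disjoint_bits: "and a b = 0 \<longleftrightarrow> (\<forall>i. \<not> (bit a i \<and> bit b i))"
  for a b :: "'a::semiring_bit_operations"
  by (auto simp: bit_eq_iff bit_and_iff dest: bit_imp_possible_bit)

lemma add_eq_xor_add_double_and: "a + b = xor a b + 2 * and a b"
  for a b :: "'a::semiring_bit_operations"
proof -
  define c where "c = and a b"
  have "and (xor a c) c = 0" "and (xor b c) c = 0" "and (xor a c) (xor b c) = 0"
    by (auto simp: c_def and_eq_0_iff_disjoint_bits bit_simps)
  then have "xor a c + c = xor (xor a c) c" "xor b c + c = xor (xor b c) c"
    and sum: "xor a c + xor b c = xor (xor a c) (xor b c)"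
    by (simp_all add: disjunctive_add_eq_xor)
  then have a: "a = xor a c + c" and b: "b = xor b c + c"
    by (simp_all add: xor.assoc)
  have "a + b = (xor a c + xor b c) + 2 * c"
    by (subst a, subst b) (simp only: mult_2 add_ac)
  also have "xor a c + xor b c = xor a b"
    unfolding sum by (rule bit_eqI) (auto simp: bit_simps)
  finally show ?thesis by (simp add: c_def)
qed

lemma disjoint_add_nonnegative_int_iff:
  fixes k l :: int
  assumes "and k l = 0"
  shows "0 \<le> k + l \<longleftrightarrow> 0 \<le> k \<and> 0 \<le> l"
  using assms by (simp add: disjunctive_add_eq_or)

definition submasks :: "'a::semiring_bit_operations \<Rightarrow> 'a set" where
  "submasks x = {m. \<forall>i. bit m i \<longrightarrow> bit x i}"

lemma submasks_0: "submasks 0 = {0}"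
  by (auto simp: submasks_def intro: bit_eqI)

lemma xor_mem_submasks: "m \<in> submasks x \<Longrightarrow> xor x m \<in> submasks x"
  by (auto simp: submasks_def bit_xor_iff)

lemma mem_submasks_unset_bit_iff:
  "m \<in> submasks (unset_bit n x) \<longleftrightarrow> m \<in> submasks x \<and> \<not> bit m n"
  by (auto simp: submasks_def bit_unset_bit_iff)

lemma inj_on_or_submasks:
  assumes "and d x = 0"
  shows "inj_on (or d) (submasks x)"
proof (rule inj_onI)
  fix m m' assume "m \<in> submasks x" "m' \<in> submasks x" "or d m = or d m'"
  moreover have "\<not> bit d i" if "bit x i" for i
    using assms that by (auto simp: and_eq_0_iff_disjoint_bits)
  ultimately show "m = m'"
    unfolding bit_eq_iff submasks_def bit_or_iff by blast
qed

lemma bij_betw_nat_bits: "bij_betw (\<lambda>n :: nat. {i. bit n i}) UNIV {M. finite M}"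
proof (rule bij_betwI')
  show "{i. bit m i} = {i. bit n i} \<longleftrightarrow> m = n" for m n :: nat
    by (auto simp: bit_eq_iff)
  show "{i. bit n i} \<in> {M. finite M}" for n :: nat
    by (simp add: finite_bits_nat)
  show "\<exists>n \<in> UNIV. M = {i. bit (n :: nat) i}" if "M \<in> {M. finite M}" for M
    using that unfolding mem_Collect_eq
  proof (induction M)
    case empty
    show ?case by (intro bexI [of _ 0]) simp_all
  next
    case (insert j M)
    then obtain n :: nat where "M = {i. bit n i}" by blast
    then have "insert j M = {i. bit (set_bit j n) i}"
      by (auto simp: bit_set_bit_iff)
    then show ?case by blast
  qed
qed

lemma card_submasks: "card (submasks n) = 2 ^ popcount n"
proof -
  have "(\<lambda>m. {i. bit m i}) ` submasks n = Pow {i. bit n i}"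
  proof (intro equalityI subsetI)
    fix M assume M: "M \<in> Pow {i. bit n i}"
    then have "finite M" by (auto intro: finite_subset finite_bits_nat)
    then obtain m :: nat where "M = {i. bit m i}"
      using bij_betw_imp_surj_on [OF bij_betw_nat_bits] by blast
    with M show "M \<in> (\<lambda>m. {i. bit m i}) ` submasks n"
      by (auto simp: submasks_def)
  qed (auto simp: submasks_def)
  then have "bij_betw (\<lambda>m. {i. bit m i}) (submasks n) (Pow {i. bit n i})"
    by (rule bij_betw_subset [OF bij_betw_nat_bits subset_UNIV])
  from bij_betw_same_card [OF this] show ?thesis
    by (simp add: card_Pow finite_bits_nat popcount_def)
qed

lemma popcount_unset_bit:
  assumes "bit n i"
  shows "popcount (unset_bit i n) = popcount n - 1"
proof -
  have "{j. bit (unset_bit i n) j} = {j. bit n j} - {i}"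
    by (auto simp: bit_unset_bit_iff)
  then show ?thesis
    using assms by (simp add: popcount_def finite_bits_nat)
qed

definition xor_and_pairs :: "'a::semiring_bit_operations \<Rightarrow> 'a \<Rightarrow> 'a set set" where
  "xor_and_pairs x d = {{a, b} | a b. xor a b = x \<and> and a b = d}"

definition distribute_bits :: "'a::semiring_bit_operations \<Rightarrow> 'a \<Rightarrow> 'a \<Rightarrow> 'a set" where
  "distribute_bits d x m = {or d m, or d (xor x m)}"

lemma distribute_bits_mem_xor_and_pairs:
  assumes "and d x = 0" "m \<in> submasks x"
  shows "distribute_bits d x m \<in> xor_and_pairs x d"
proof -
  have "xor (or d m) (or d (xor x m)) = x" "and (or d m) (or d (xor x m)) = d"
    by (rule bit_eqI; use assms in \<open>auto simp: and_eq_0_iff_disjoint_bits submasks_def bit_simps\<close>)+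
  then show ?thesis
    unfolding xor_and_pairs_def distribute_bits_def by blast
qed

lemma distribute_bits_and_xor: "distribute_bits (and a b) (xor a b) (and a (xor a b)) = {a, b}"
proof -
  have "or (and a b) (and a (xor a b)) = a" "or (and a b) (xor (xor a b) (and a (xor a b))) = b"
    by (rule bit_eqI; auto simp: bit_simps)+
  then show ?thesis by (simp add: distribute_bits_def)
qed

lemma xor_and_pairs_eq_image:
  assumes "and d x = 0"
  shows "xor_and_pairs x d = distribute_bits d x ` submasks x"
proof (intro equalityI subsetI)
  fix s assume "s \<in> xor_and_pairs x d"
  then obtain a b where "s = {a, b}" "xor a b = x" "and a b = d"
    unfolding xor_and_pairs_def by blast
  then have "s = distribute_bits d x (and a x)"
    using distribute_bits_and_xor by metis
  moreover have "and a x \<in> submasks x"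
    by (simp add: submasks_def bit_and_iff)
  ultimately show "s \<in> distribute_bits d x ` submasks x" by blast
qed (use distribute_bits_mem_xor_and_pairs [OF assms] in blast)

lemma distribute_bits_eq_iff:
  assumes "and d x = 0" "m \<in> submasks x" "m' \<in> submasks x"
  shows "distribute_bits d x m = distribute_bits d x m' \<longleftrightarrow> m = m' \<or> m = xor x m'"
proof -
  have "or d k = or d l \<longleftrightarrow> k = l" if "k \<in> submasks x" "l \<in> submasks x" for k l
    using inj_on_or_submasks [OF assms(1)] that by (rule inj_on_eq_iff)
  then have "distribute_bits d x m = distribute_bits d x m' \<longleftrightarrow>
      m = m' \<and> xor x m = xor x m' \<or> m = xor x m' \<and> xor x m = m'"
    using assms(2,3) by (simp add: distribute_bits_def doubleton_eq_iff xor_mem_submasks)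
  then show ?thesis by (auto simp flip: xor.assoc)
qed

lemma bij_betw_distribute_bits:
  assumes "and d x = 0" "bit x n"
  shows "bij_betw (distribute_bits d x) (submasks (unset_bit n x)) (xor_and_pairs x d)"
proof (rule bij_betw_imageI)
  show "inj_on (distribute_bits d x) (submasks (unset_bit n x))"
  proof (rule inj_onI)
    fix m m'
    assume m: "m \<in> submasks (unset_bit n x)" "m' \<in> submasks (unset_bit n x)"
      and "distribute_bits d x m = distribute_bits d x m'"
    then have "m = m' \<or> m = xor x m'"
      using assms(1) by (simp add: mem_submasks_unset_bit_iff distribute_bits_eq_iff)
    moreover have "m \<noteq> xor x m'"
      using m assms(2) by (auto simp: mem_submasks_unset_bit_iff bit_xor_iff)
    ultimately show "m = m'" by blast
  qed
  have "distribute_bits d x m \<in> distribute_bits d x ` submasks (unset_bit n x)"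
    if m: "m \<in> submasks x" for m
  proof (cases "bit m n")
    case True
    then have "xor x m \<in> submasks (unset_bit n x)"
      using m assms(2) by (simp add: mem_submasks_unset_bit_iff xor_mem_submasks bit_xor_iff)
    moreover have "distribute_bits d x (xor x m) = distribute_bits d x m"
      using assms(1) m by (simp add: distribute_bits_eq_iff xor_mem_submasks)
    ultimately show ?thesis by (metis imageI)
  qed (use m in \<open>simp add: mem_submasks_unset_bit_iff\<close>)
  then show "distribute_bits d x ` submasks (unset_bit n x) = xor_and_pairs x d"
    unfolding xor_and_pairs_eq_image [OF assms(1)] by (auto simp: mem_submasks_unset_bit_iff)
qed

lemma card_xor_and_pairs:
  fixes x d :: nat
  assumes "and d x = 0"
  shows "card (xor_and_pairs x d) = 2 ^ (popcount x - 1)"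
proof (cases "x = 0")
  case True
  with xor_and_pairs_eq_image [OF assms] show ?thesis
    by (simp add: submasks_0 popcount_0)
next
  case False
  then obtain n where n: "bit x n"
    by (auto simp: bit_eq_iff)
  show ?thesis
    using bij_betw_same_card [OF bij_betw_distribute_bits [OF assms n]]
    by (simp add: card_submasks popcount_unset_bit [OF n])
qed

lemma xor_and_pairs_with_0: "{s \<in> xor_and_pairs x d. 0 \<in> s} = (if d = 0 then {{0, x}} else {})"
proof (intro equalityI subsetI)
  fix s assume "s \<in> {s \<in> xor_and_pairs x d. 0 \<in> s}"
  then show "s \<in> (if d = 0 then {{0, x}} else {})"
    by (auto simp: xor_and_pairs_def insert_commute)
next
  fix s assume "s \<in> (if d = 0 then {{0, x}} else {})"
  then have "d = 0" "s = {0, x}" by (simp_all split: if_splits)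
  moreover have "xor 0 x = x" "and 0 x = 0" by simp_all
  ultimately show "s \<in> {s \<in> xor_and_pairs x d. 0 \<in> s}"
    unfolding xor_and_pairs_def by blast
qed

lemma xor_pairs_eq: "xor_pairs (X + 2 * D) X = {s \<in> xor_and_pairs X D. 0 \<notin> s}"
proof -
  have "a + b = X + 2 * D \<and> xor a b = X \<longleftrightarrow> xor a b = X \<and> and a b = D" for a b
    using add_eq_xor_add_double_and [of a b] by auto
  then have "xor_pairs (X + 2 * D) X =
      {{a, b} | a b. 0 < a \<and> 0 < b \<and> xor a b = X \<and> and a b = D}"
    unfolding xor_pairs_def by simp
  also have "\<dots> = {s \<in> xor_and_pairs X D. 0 \<notin> s}"
    unfolding xor_and_pairs_def by fastforce
  finally show ?thesis .
qed

lemma card_xor_pairs: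
  assumes "and D X = 0"
  shows "card (xor_pairs (X + 2 * D) X) = 2 ^ (popcount X - 1) - of_bool (D = 0)"
proof -
  let ?Z = "{s \<in> xor_and_pairs X D. 0 \<in> s}"
  have "xor_pairs (X + 2 * D) X = xor_and_pairs X D - ?Z"
    unfolding xor_pairs_eq by blast
  moreover have "finite ?Z" "card ?Z = of_bool (D = 0)"
    by (simp_all add: xor_and_pairs_with_0)
  ultimately show ?thesis
    using card_xor_and_pairs [OF assms] by (simp add: card_Diff_subset)
qed

lemma xor_pairs_nonemptyE:
  assumes "xor_pairs S X \<noteq> {}"
  obtains D where "S = X + 2 * D" "and D X = 0"
proof -
  from assms obtain a b where "a + b = S" "xor a b = X"
    unfolding xor_pairs_def by blast
  moreover have "and (and a b) (xor a b) = 0"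
    by (auto simp: and_eq_0_iff_disjoint_bits bit_simps)
  ultimately show thesis
    using that [of "and a b"] add_eq_xor_add_double_and [of a b] by simp
qed

lemma pair_formula_disjoint:
  assumes "and D X = 0"
  shows "pair_formula (X + 2 * D) X = 2 ^ (popcount X - 1) - of_bool (D = 0)"
  using assms by (auto simp: pair_formula_def and_eq_0_iff_disjoint_bits bit_of_nat_iff_bit)

lemma pair_formula_nonzeroE:
  assumes "pair_formula S X \<noteq> 0"
  obtains D where "S = X + 2 * D" "and D X = 0"
proof -
  define d where "d = (int S - int X) div 2"
  have "even (int S - int X)" and disj: "\<not> (bit d i \<and> bit X i)" for i
    using assms by (auto simp: pair_formula_def d_def split: if_splits)
  then have S: "int S = int X + 2 * d" by (simp add: d_def)
  have "and d (int X) = 0"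
    using disj by (simp add: and_eq_0_iff_disjoint_bits bit_of_nat_iff_bit)
  moreover have "0 \<le> d + int X" using S by linarith
  ultimately have "0 \<le> d" using disjoint_add_nonnegative_int_iff by blast
  then obtain D where D: "d = int D" by (rule nonneg_int_cases)
  show thesis
  proof
    show "S = X + 2 * D" using S D by linarith
    show "and D X = 0"
      using disj by (simp add: D and_eq_0_iff_disjoint_bits bit_of_nat_iff_bit)
  qed
qed

theorem theorem7p2:
  fixes S X :: nat
  shows "int (card (xor_pairs S X)) = pair_formula S X"
proof (cases "\<exists>D. S = X + 2 * D \<and> and D X = 0")
  case True
  then obtain D where "S = X + 2 * D" "and D X = 0" by blast
  then show ?thesis
    by (simp add: card_xor_pairs pair_formula_disjoint of_nat_diff)
next
  case False
  then have "xor_pairs S X = {}" by (metis xor_pairs_nonemptyE)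
  moreover have "pair_formula S X = 0" using False by (metis pair_formula_nonzeroE)
  ultimately show ?thesis by simp
qed

end
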